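(* Let $Y\sim N(0,1)$ be a standard normal random variable. For every integer $n\ge 0$ and every real $x$, $$\mathcal{E}_{n,\lambda}^{Y}(x)=\sum_{j=0}^{n}\sum_{k=0}^{[j/2]}E_{k}(x)\binom{2k}{k}\frac{k!}{2^{k}}S_{1}(j,2k){n \brace j}_{\lambda}.$$
   Context: $\lambda$ is a fixed nonzero real number, and $[j/2]$ denotes the integer part of $j/2$. For real $x$ and $n\ge1$: $(x)_{n}=x(x-1)\cdots(x-n+1)$, $(x)_{n,\lambda}=x(x-\lambda)\cdots(x-(n-1)\lambda)$, and $(x)_0=(x)_{0,\lambda}=1$. The (signed) Stirling numbers of the first kind $S_1(n,k)$ and the degenerate Stirling numbers of the second kind ${n\brace k}_\lambda$ are defined by the polynomial identities $(x)_n=\sum_{k=0}^nS_1(n,k)x^k$ and $(x)_{n,\lambda}=\sum_{k=0}^n{n\brace k}_\lambda(x)_k$, $n\ge0$. $E_k(x)$ are the ordinary Euler polynomials: $\frac{2}{e^t+1}e^{xt}=\sum_{n\ge0}E_n(x)\frac{t^n}{n!}$. The degenerate exponential is $e_{\lambda}^{x}(t)=(1+\lambda t)^{x/\lambda}=\sum_{n\ge0}(x)_{n,\lambda}\frac{t^n}{n!}$, and $E[e_{\lambda}^{Y}(t)]=\sum_{n\ge0}E[(Y)_{n,\lambda}]\frac{t^n}{n!}$ for $t$ near $0$ (here $E[\cdot]$ is expectation). The probabilistic degenerate Euler polynomials associated with $Y$ are defined by the power series expansion at $t=0$: $\frac{2}{E[e_{\lambda}^{Y}(t)]+1}\big(E[e_{\lambda}^{Y}(t)]\big)^{x}=\sum_{n\ge0}\mathcal{E}_{n,\lambda}^{Y}(x)\frac{t^n}{n!}$.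 *)

theory Defs
  imports "HOL-Probability.Probability" "HOL-Analysis.FPS_Convergence"
begin

definition deg_ffact :: "'a::comm_ring_1 \<Rightarrow> 'a \<Rightarrow> nat \<Rightarrow> 'a" where
  "deg_ffact l x n = (\<Prod>i<n. x - of_nat i * l)"

text \<open>Signed Stirling numbers of the first kind: the coefficients of the falling factorial,
  taken in the polynomial ring.\<close>

definition stirling1 :: "nat \<Rightarrow> nat \<Rightarrow> real" where
  "stirling1 n k = poly.coeff (deg_ffact 1 [:0, 1:] n) k"

definition deg_stirling2 :: "real \<Rightarrow> nat \<Rightarrow> nat \<Rightarrow> real" where
  "deg_stirling2 l n =
     (THE c. (\<forall>k>n. c k = 0) \<and> (\<forall>x. deg_ffact l x n = (\<Sum>k\<le>n. c k * deg_ffact 1 x k)))"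

definition euler_poly :: "nat \<Rightarrow> real \<Rightarrow> real" where
  "euler_poly n x = fact n * fps_nth (fps_const 2 / (fps_exp 1 + 1) * fps_exp x) n"

definition deg_exp :: "real \<Rightarrow> real \<Rightarrow> real \<Rightarrow> real" where
  "deg_exp l x t = (1 + l * t) powr (x / l)"

definition deg_mgf :: "real \<Rightarrow> 'a measure \<Rightarrow> ('a \<Rightarrow> real) \<Rightarrow> real \<Rightarrow> real" where
  "deg_mgf l M Y t = (\<integral>\<omega>. deg_exp l (Y \<omega>) t \<partial>M)"

text \<open>The expansion is that of the generating function as a real function near \<open>0\<close>, where
  \<open>deg_mgf\<close> is an actual expectation; the value is meaningful only if an expansion exists.\<close>

definition prob_deg_euler :: "real \<Rightarrow> 'a measure \<Rightarrow> ('a \<Rightarrow> real) \<Rightarrow> nat \<Rightarrow> real \<Rightarrow> real" where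
  "prob_deg_euler l M Y n x = fact n * fps_nth
     (THE F. (\<lambda>t. 2 / (deg_mgf l M Y t + 1) * deg_mgf l M Y t powr x) has_fps_expansion F) n"

lemma poly_deg_ffact: "poly (deg_ffact p q n) x = deg_ffact (poly p x) (poly q x) n"
  by (simp add: deg_ffact_def poly_prod)

lemma degree_ffact: "degree (deg_ffact 1 [:0, 1::real:] n) = n"
  and monic_ffact: "lead_coeff (deg_ffact 1 [:0, 1::real:] n) = 1"
proof -
  have *: "deg_ffact 1 [:0, 1::real:] n = (\<Prod>i<n. [:- real i, 1:])"
    by (simp add: deg_ffact_def of_nat_poly)
  show "degree (deg_ffact 1 [:0, 1::real:] n) = n"
    unfolding * by (subst degree_prod_eq_sum_degree) auto
  show "lead_coeff (deg_ffact 1 [:0, 1::real:] n) = 1"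
    unfolding * by (simp add: lead_coeff_prod)
qed

lemma stirling1_identity: "deg_ffact 1 x n = (\<Sum>k\<le>n. stirling1 n k * x ^ k)"
proof -
  have "deg_ffact 1 x n = poly (deg_ffact 1 [:0, 1:] n) x"
    by (simp add: poly_deg_ffact)
  then show ?thesis
    by (simp add: poly_altdef degree_ffact stirling1_def)
qed

lemma deg_stirling2_exists:
  "\<exists>c. (\<forall>k>n. c k = 0) \<and> (\<forall>x. deg_ffact l x n = (\<Sum>k\<le>n. c k * deg_ffact 1 (x::real) k))"
proof (induction n)
  case 0
  show ?case by (rule exI[of _ "\<lambda>k. if k = 0 then 1 else 0"]) (simp add: deg_ffact_def)
next
  case (Suc n)
  then obtain c where c0: "\<forall>k>n. c k = 0"
    and c: "\<And>x. deg_ffact l x n = (\<Sum>k\<le>n. c k * deg_ffact 1 (x::real) k)" by blast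
  define d where "d k = (if k = 0 then 0 else c (k - 1)) + (real k - real n * l) * c k" for k
  have "deg_ffact l x (Suc n) = (\<Sum>k\<le>Suc n. d k * deg_ffact 1 x k)" for x
  proof -
    have step: "deg_ffact 1 x (Suc k) = (x - real k) * deg_ffact 1 x k" for k
      by (simp add: deg_ffact_def)
    have "deg_ffact l x (Suc n) = (x - real n * l) * (\<Sum>k\<le>n. c k * deg_ffact 1 x k)"
      by (simp add: c[symmetric]) (simp add: deg_ffact_def)
    also have "\<dots> = (\<Sum>k\<le>n. c k * deg_ffact 1 x (Suc k)
                     + (real k - real n * l) * c k * deg_ffact 1 x k)"
      unfolding sum_distrib_left step by (intro sum.cong) (auto simp: algebra_simps)
    also have "\<dots> = (\<Sum>k\<le>n. c k * deg_ffact 1 x (Suc k))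
                   + (\<Sum>k\<le>Suc n. (real k - real n * l) * c k * deg_ffact 1 x k)"
      using c0 by (simp add: sum.distrib)
    also have "(\<Sum>k\<le>n. c k * deg_ffact 1 x (Suc k))
                 = (\<Sum>k\<le>Suc n. (if k = 0 then 0 else c (k - 1)) * deg_ffact 1 x k)"
      by (subst sum.atMost_Suc_shift) simp
    finally show ?thesis
      by (simp only: d_def distrib_right sum.distrib add.commute)
  qed
  moreover have "\<forall>k>Suc n. d k = 0"
    using c0 by (simp add: d_def)
  ultimately show ?case by blast
qed

lemma ffact_independent:
  assumes "\<And>x::real. (\<Sum>k\<le>n. c k * deg_ffact 1 x k) = 0" "k \<le> n"
  shows "c k = 0"
proof -
  have "(\<forall>x::real. (\<Sum>k\<le>n. c k * deg_ffact 1 x k) = 0) \<longrightarrow> (\<forall>k\<le>n. c k = 0)"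
  proof (induction n)
    case 0
    show ?case by (simp add: deg_ffact_def)
  next
    case (Suc n)
    show ?case
    proof
      assume *: "\<forall>x::real. (\<Sum>k\<le>Suc n. c k * deg_ffact 1 x k) = 0"
      let ?p = "\<Sum>k\<le>Suc n. smult (c k) (deg_ffact 1 [:0, 1:] k)"
      have "poly ?p x = 0" for x
        using *[rule_format, of x] by (simp add: poly_sum poly_deg_ffact)
      then have "?p = 0"
        using poly_all_0_iff_0 by blast
      then have "poly.coeff ?p (Suc n) = 0" by simp
      moreover have "poly.coeff ?p (Suc n) = c (Suc n)"
        using monic_ffact[of "Suc n"]
        by (simp add: coeff_sum degree_ffact coeff_eq_0)
      ultimately have "c (Suc n) = 0" by simp
      with * Suc.IH show "\<forall>k\<le>Suc n. c k = 0"
        by (auto simp: le_Suc_eq)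
    qed
  qed
  with assms show ?thesis by blast
qed

lemma deg_stirling2_unique:
  "\<exists>!c. (\<forall>k>n. c k = 0) \<and> (\<forall>x. deg_ffact l x n = (\<Sum>k\<le>n. c k * deg_ffact 1 (x::real) k))"
proof (rule ex_ex1I[OF deg_stirling2_exists])
  fix c d :: "nat \<Rightarrow> real"
  assume c: "(\<forall>k>n. c k = 0) \<and> (\<forall>x. deg_ffact l x n = (\<Sum>k\<le>n. c k * deg_ffact 1 x k))"
    and d: "(\<forall>k>n. d k = 0) \<and> (\<forall>x. deg_ffact l x n = (\<Sum>k\<le>n. d k * deg_ffact 1 x k))"
  have "(\<Sum>k\<le>n. (c k - d k) * deg_ffact 1 x k) = 0" for x
    using c[THEN conjunct2, rule_format, of x] d[THEN conjunct2, rule_format, of x]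
    by (simp add: left_diff_distrib sum_subtractf)
  then have "c k - d k = 0" if "k \<le> n" for k
    using ffact_independent[of "\<lambda>k. c k - d k" n] that by blast
  with c d show "c = d"
    by (metis eq_iff_diff_eq_0 ext linorder_not_le)
qed

lemma deg_stirling2_identity:
  "deg_ffact l x n = (\<Sum>k\<le>n. deg_stirling2 l n k * deg_ffact 1 x k)"
  using theI'[OF deg_stirling2_unique[of n l]] unfolding deg_stirling2_def by blast

lemma euler_poly_gf:
  "(fps_exp 1 + 1) * Abs_fps (\<lambda>n. euler_poly n x / fact n) = fps_const 2 * fps_exp x"
proof -
  have "Abs_fps (\<lambda>n. euler_poly n x / fact n) = fps_const 2 / (fps_exp 1 + 1) * fps_exp x"
    by (simp add: fps_eq_iff euler_poly_def)
  then show ?thesis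
    by (simp add: fps_divide_unit inverse_mult_eq_1' mult.left_commute flip: mult.assoc)
qed

end

theory Submission
  imports Defs
begin

unbundle no vec_syntax
unbundle fps_syntax

text \<open>
  With \<open>s = ln (1 + l t) / l\<close> the degenerate exponential is \<open>exp (s Y)\<close>, whose Gaussian
  expectation is \<open>exp (s\<^sup>2 / 2)\<close>. So the generating function is that of the ordinary Euler
  polynomials, evaluated at \<open>s\<^sup>2 / 2\<close>. On the other hand \<open>s ^ m / m!\<close> generates the
  coefficients of \<open>x ^ m\<close> in the degenerate falling factorials (a differential equation for \<open>s\<close>
  gives their recurrence), and these coefficients are products of the two Stirling matrices.
\<close>

section \<open>Composition of convergent power series\<close>

lemma has_fps_expansion_transform:
  assumes "eventually (\<lambda>x. f x = g x) (nhds 0)" "f has_fps_expansion F"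
  shows "g has_fps_expansion F"
  using assms(2) unfolding has_fps_expansion_def
  by (auto elim!: eventually_elim2[OF assms(1)])

text \<open>If \<open>F\<close> and \<open>G\<close> differed, dividing the zero function by the
  power of \<open>x\<close> of exponent \<open>subdegree (F - G)\<close> would leave a function
  continuous at 0, zero elsewhere, yet nonzero at 0. This makes the \<open>THE\<close> in
  \<open>prob_deg_euler\<close> well determined.\<close>

lemma has_fps_expansion_unique:
  fixes F G :: "'a :: {banach, real_normed_field} fps"
  assumes "f has_fps_expansion F" "f has_fps_expansion G"
  shows "F = G"
proof (rule ccontr)
  assume "F \<noteq> G"
  let ?n = "subdegree (F - G)"
  let ?c = "(F - G) $ ?n"
  from assms have "(\<lambda>x. f x - f x) has_fps_expansion (F - G)"
    by (intro has_fps_expansion_diff)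
  hence "(\<lambda>x. if x = 0 then ?c else (f x - f x) / x ^ ?n) has_fps_expansion fps_shift ?n (F - G)"
    by (intro has_fps_expansion_shift) auto
  hence "isCont (\<lambda>x. if x = 0 then ?c else (f x - f x) / x ^ ?n) 0"
    by (rule has_fps_expansion_imp_continuous)
  hence "((\<lambda>x. if x = 0 then ?c else (f x - f x) / x ^ ?n) \<longlongrightarrow> ?c) (at 0)"
    by (simp add: isCont_def)
  moreover have "((\<lambda>x. if x = 0 then ?c else (f x - f x) / x ^ ?n) \<longlongrightarrow> 0) (at 0)"
    by (rule tendsto_eventually) (simp add: eventually_at_filter)
  ultimately have "?c = 0"
    by (rule LIM_unique)
  with \<open>F \<noteq> G\<close> show False
    by (metis nth_subdegree_nonzero right_minus_eq)
qed

text \<open>By induction with the triangle inequality: the series of norms majorizes, and so do its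
  powers.\<close>

lemma norm_fps_power_nth_le:
  fixes G :: "'a :: real_normed_field fps"
  shows "norm ((G ^ m) $ n) \<le> (Abs_fps (\<lambda>i. norm (G $ i)) ^ m) $ n"
proof (induction m arbitrary: n)
  case (Suc m)
  let ?A = "Abs_fps (\<lambda>i. norm (G $ i))"
  have "norm ((G ^ Suc m) $ n) \<le> (\<Sum>i=0..n. norm (G $ i * (G ^ m) $ (n - i)))"
    by (simp add: fps_mult_nth norm_sum)
  also have "\<dots> \<le> (\<Sum>i=0..n. ?A $ i * (?A ^ m) $ (n - i))"
    by (intro sum_mono) (auto simp: norm_mult intro!: mult_left_mono Suc.IH)
  finally show ?case by (simp add: fps_mult_nth)
qed auto

lemma has_sum_eval_fps_power:
  fixes A :: "'a :: {banach, real_normed_field} fps"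
  assumes "norm t < fps_conv_radius A"
  shows "((\<lambda>n. (A ^ m) $ n * t ^ n) has_sum eval_fps A t ^ m) UNIV"
proof -
  have r: "norm t < fps_conv_radius (A ^ m)"
    using assms fps_conv_radius_power[of A m] by simp
  show ?thesis
    using norm_summable_imp_has_sum[OF norm_summable_fps[OF r] sums_eval_fps[OF r]] assms
    by (simp add: eval_fps_power)
qed

text \<open>The double series is dominated by \<open>\<Sum>\<^sub>m \<bar>F\<^sub>m\<bar> (\<Sum>\<^sub>n \<bar>G\<^sub>n\<bar> \<bar>t\<bar> ^ n) ^ m\<close>, so it may be rearranged.\<close>

lemma sums_fps_compose:
  fixes F G :: "'a :: {banach, real_normed_field} fps"
  defines "A \<equiv> Abs_fps (\<lambda>n. norm (G $ n))"
  assumes G0: "G $ 0 = 0"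
    and t: "norm t < fps_conv_radius G"
    and At: "norm (eval_fps A (norm t)) < fps_conv_radius F"
    and Gt: "norm (eval_fps G t) < fps_conv_radius F"
  shows "(\<lambda>n. (F oo G) $ n * t ^ n) sums eval_fps F (eval_fps G t)"
proof -
  define h where "h = (\<lambda>(m, n). F $ m * ((G ^ m) $ n * t ^ n))"
  define b where "b = (\<lambda>(m, n). norm (F $ m) * ((A ^ m) $ n * norm t ^ n))"
  have A: "fps_conv_radius A = fps_conv_radius G"
    by (simp add: A_def)
  have A_nonneg: "(A ^ m) $ n \<ge> 0" for m n
    using order_trans[OF norm_ge_zero norm_fps_power_nth_le[of G m n]] by (simp add: A_def)
  have A_sums: "(\<lambda>n. A $ n * norm t ^ n) sums eval_fps A (norm t)"
    using t A by (intro sums_eval_fps) simp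
  have e0: "eval_fps A (norm t) \<ge> 0"
    by (rule sums_le[OF _ sums_zero A_sums]) (simp add: A_def)
  have b_row: "((\<lambda>n. b (m, n)) has_sum norm (F $ m) * eval_fps A (norm t) ^ m) UNIV" for m
    unfolding b_def prod.case
    using t A by (intro has_sum_cmult_right has_sum_eval_fps_power) simp
  \<comment> \<open>The real value is embedded into the field because \<open>F\<close> has its
    coefficients there; the norm is unchanged.\<close>
  have "norm (of_real (eval_fps A (norm t)) :: 'a) < fps_conv_radius F"
    using At by simp
  from norm_summable_fps[OF this]
  have "summable (\<lambda>m. norm (F $ m) * eval_fps A (norm t) ^ m)"
    using e0 by (simp add: norm_mult norm_power)
  hence "(\<lambda>m. norm (F $ m) * eval_fps A (norm t) ^ m) summable_on UNIV"
    using e0 by (subst summable_on_UNIV_nonneg_real_iff) auto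
  hence "b summable_on (UNIV \<times> UNIV)"
    using b_row A_nonneg
    by (intro summable_on_SigmaI[where g = "\<lambda>m. norm (F $ m) * eval_fps A (norm t) ^ m"])
       (auto simp: b_def)
  hence "(\<lambda>p. norm (h p)) summable_on (UNIV \<times> UNIV)"
    by (rule summable_on_comparison_test)
       (auto simp: h_def b_def A_def norm_mult norm_power
         intro!: mult_left_mono mult_right_mono norm_fps_power_nth_le)
  hence "h summable_on (UNIV \<times> UNIV)"
    by (rule abs_summable_summable)
  then obtain S where S: "(h has_sum S) (UNIV \<times> UNIV)"
    by (auto simp: summable_on_def)
  \<comment> \<open>The same total \<open>S\<close> is computed twice: summing over \<open>n\<close>
    first gives powers of \<open>eval_fps G t\<close>, summing over \<open>m\<close> first gives
    coefficients of the composition.\<close>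
  have rows: "((\<lambda>m. F $ m * eval_fps G t ^ m) has_sum S) UNIV"
  proof (rule has_sum_SigmaD[OF S])
    show "((\<lambda>n. h (m, n)) has_sum F $ m * eval_fps G t ^ m) UNIV" for m
      unfolding h_def prod.case by (intro has_sum_cmult_right has_sum_eval_fps_power t)
  qed
  have cols: "((\<lambda>n. (F oo G) $ n * t ^ n) has_sum S) UNIV"
  proof (rule has_sum_SigmaD)
    show "((\<lambda>(n, m). h (m, n)) has_sum S) (UNIV \<times> UNIV)"
      using S by (subst (asm) has_sum_swap)
    show "((\<lambda>m. (\<lambda>(n, m). h (m, n)) (n, m)) has_sum (F oo G) $ n * t ^ n) UNIV" for n
    proof (rule has_sum_finite_neutralI[where B = "{0..n}"])
      show "(F oo G) $ n * t ^ n = (\<Sum>m=0..n. case (n, m) of (n, m) \<Rightarrow> h (m, n))"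
        by (simp add: h_def fps_compose_nth sum_distrib_left sum_distrib_right mult_ac)
    \<comment> \<open>As \<open>G $ 0 = 0\<close>, the power \<open>G ^ m\<close> starts at degree
      \<open>m\<close> or later, so only \<open>m \<le> n\<close> contributes to the
      \<open>n\<close>-th coefficient.\<close>
    qed (auto simp: h_def startsby_zero_power_prefix[OF G0, rule_format])
  qed
  have "S = eval_fps F (eval_fps G t)"
    using has_sum_imp_sums[OF rows] sums_eval_fps[OF Gt] sums_unique2 by blast
  with has_sum_imp_sums[OF cols] show ?thesis by simp
qed

text \<open>Since \<open>G $ 0 = 0\<close>, both \<open>G\<close> and its series of norms tend to 0
  at 0, so near 0 they stay inside the disc of convergence of \<open>F\<close>, as
  \<open>sums_fps_compose\<close> requires.\<close>

lemma has_fps_expansion_compose_normed_field: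
  fixes F G :: "'a :: {banach, real_normed_field} fps"
  assumes f: "f has_fps_expansion F" and g: "g has_fps_expansion G" and G0: "G $ 0 = 0"
  shows "(\<lambda>t. f (g t)) has_fps_expansion (F oo G)"
proof (rule has_fps_expansionI)
  define A where "A = Abs_fps (\<lambda>n. norm (G $ n))"
  have rF: "fps_conv_radius F > 0" and rG: "fps_conv_radius G > 0"
    using f g by (auto simp: has_fps_expansion_def)
  have rA: "fps_conv_radius A = fps_conv_radius G"
    by (simp add: A_def)
  obtain r where r: "r > 0" "ereal r < fps_conv_radius F"
    using rF ereal_dense2[of 0] by (auto simp: zero_ereal_def)
  have "isCont (eval_fps G) 0" "isCont (eval_fps A) 0"
    using rG rA by (auto intro!: continuous_eval_fps simp: zero_ereal_def)
  hence "(eval_fps G \<longlongrightarrow> eval_fps G 0) (nhds 0)" "(eval_fps A \<longlongrightarrow> eval_fps A 0) (nhds 0)"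
    by (simp_all only: isCont_def tendsto_at_iff_tendsto_nhds)
  hence limG: "(eval_fps G \<longlongrightarrow> 0) (nhds 0)" and limA: "(eval_fps A \<longlongrightarrow> 0) (nhds 0)"
    using G0 by (simp_all add: eval_fps_at_0 A_def)
  have "((\<lambda>t::'a. eval_fps A (norm t)) \<longlongrightarrow> 0) (nhds 0)"
    by (rule filterlim_compose[OF limA])
       (use tendsto_norm[OF filterlim_ident[of "nhds (0::'a)"]] in simp)
  hence evA: "eventually (\<lambda>t::'a. norm (eval_fps A (norm t)) < r) (nhds 0)"
    using r by (auto dest!: tendstoD[where e = r])
  have evG: "eventually (\<lambda>t. norm (eval_fps G t) < r) (nhds 0)"
    using r limG by (auto dest!: tendstoD[where e = r])
  have "eventually (\<lambda>t::'a. t \<in> eball 0 (fps_conv_radius G)) (nhds 0)"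
    using rG by (intro eventually_nhds_in_open) (auto simp: zero_ereal_def)
  moreover have "eventually (\<lambda>t. eval_fps F (eval_fps G t) = f (eval_fps G t)) (nhds 0)"
    using limG f by (auto simp: has_fps_expansion_def intro: eventually_compose_filterlim)
  moreover have "eventually (\<lambda>t. eval_fps G t = g t) (nhds 0)"
    using g by (simp add: has_fps_expansion_def)
  ultimately show "eventually (\<lambda>t. (\<lambda>n. (F oo G) $ n * t ^ n) sums f (g t)) (nhds 0)"
    using evA evG
  proof eventually_elim
    case (elim t)
    have "norm (eval_fps A (norm t)) < fps_conv_radius F" "norm (eval_fps G t) < fps_conv_radius F"
      using elim r by (meson ereal_less_eq(3) le_less_trans less_imp_le)+
    with sums_fps_compose[OF G0, of t F] elim show ?case
      by (simp add: A_def)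
  qed
qed

section \<open>Powers of the degenerate logarithm\<close>

text \<open>The constant term is \<open>0\<close> since \<open>x / 0 = 0\<close>.\<close>

definition deg_log_fps :: "real \<Rightarrow> real fps" where
  "deg_log_fps l = Abs_fps (\<lambda>n. - ((- l) ^ n) / (real n * l))"

lemma deg_log_fps_nth_0 [simp]: "deg_log_fps l $ 0 = 0"
  by (simp add: deg_log_fps_def)

lemma has_fps_expansion_deg_log:
  assumes "l \<noteq> 0"
  shows "(\<lambda>t. ln (1 + l * t) / l) has_fps_expansion deg_log_fps l"
proof (rule has_fps_expansionI)
  have "eventually (\<lambda>t. t \<in> ball 0 (1 / \<bar>l\<bar>)) (nhds 0)"
    using assms by (intro eventually_nhds_in_open) auto
  thus "eventually (\<lambda>t. (\<lambda>n. deg_log_fps l $ n * t ^ n) sums (ln (1 + l * t) / l)) (nhds 0)"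
  proof eventually_elim
    case (elim t)
    have "\<bar>l * t\<bar> < 1"
      using elim assms by (simp add: abs_mult field_simps)
    from sums_divide[OF ln_series'[OF this], of l]
    have "(\<lambda>n. - ((- l * t) ^ n) / real n / l) sums (ln (1 + l * t) / l)"
      by simp
    thus ?case
      unfolding power_mult_distrib by (simp add: deg_log_fps_def)
  qed
qed

text \<open>The derivative of the logarithm series is the geometric series in
  \<open>- l\<close>.\<close>

lemma deriv_deg_log_fps:
  assumes "l \<noteq> 0"
  shows "(1 + fps_const l * fps_X) * fps_deriv (deg_log_fps l) = 1"
proof (rule fps_ext)
  have d: "fps_deriv (deg_log_fps l) $ n = (- l) ^ n" for n
    using assms by (simp add: deg_log_fps_def field_simps del: of_nat_Suc)
  show "((1 + fps_const l * fps_X) * fps_deriv (deg_log_fps l)) $ n = 1 $ n" for n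
    by (cases n) (simp_all add: distrib_right mult.assoc d del: fps_deriv_nth)
qed

text \<open>Both sides obey the same recurrence in \<open>n\<close>: appending the factor
  \<open>x - n * l\<close> to the falling factorial corresponds to the equation
  \<open>(1 + l X) (L ^ m)' = m L ^ (m - 1)\<close> for the logarithm series
  \<open>L\<close>.\<close>

lemma deg_log_fps_power_nth:
  assumes "l \<noteq> 0"
  shows "fact n * (deg_log_fps l ^ m) $ n = fact m * poly.coeff (deg_ffact [:l:] [:0, 1:] n) m"
proof (induction n arbitrary: m)
  case 0
  show ?case by (simp add: deg_ffact_def fps_power_zeroth_eq_one power_0_left)
next
  case (Suc n)
  let ?L = "deg_log_fps l" and ?P = "deg_ffact [:l:] [:0, 1:]"
  have P: "?P (Suc n) = ?P n * [:- real n * l, 1:]"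
    by (simp add: deg_ffact_def of_nat_poly mult.commute[of l])
  show ?case
  proof (cases m)
    case 0
    \<comment> \<open>For \<open>n > 0\<close> the hypothesis at exponent 0 applies, since
      \<open>?L ^ 0 = 1\<close> has no coefficient of positive degree.\<close>
    have "real n * poly.coeff (?P n) 0 = 0"
      using Suc.IH[of 0] by (cases n) auto
    with 0 show ?thesis by (auto simp: P)
  next
    case (Suc k)
    define Q where "Q = ?L ^ Suc k"
    have "fps_deriv Q = fps_const (real (Suc k)) * fps_deriv ?L * ?L ^ k"
      by (simp only: Q_def fps_deriv_power diff_Suc_1)
    hence "(1 + fps_const l * fps_X) * fps_deriv Q
        = fps_const (real (Suc k)) * ?L ^ k * ((1 + fps_const l * fps_X) * fps_deriv ?L)"
      by (simp only: mult_ac)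
    also have "\<dots> = fps_const (real (Suc k)) * ?L ^ k"
      by (simp only: deriv_deg_log_fps[OF assms] mult_1_right)
    finally have "((1 + fps_const l * fps_X) * fps_deriv Q) $ n = real (Suc k) * (?L ^ k) $ n"
      by (simp only: fps_mult_left_const_nth)
    hence "real (Suc n) * (?L ^ Suc k) $ Suc n + l * real n * (?L ^ Suc k) $ n
        = real (Suc k) * (?L ^ k) $ n"
      unfolding Q_def[symmetric] by (cases n) (simp_all add: distrib_right mult.assoc)
    hence "fact (Suc n) * (?L ^ Suc k) $ Suc n
        = real (Suc k) * (fact n * (?L ^ k) $ n) - l * real n * (fact n * (?L ^ Suc k) $ n)"
      by (simp only: fact_Suc of_nat_mult of_nat_fact) algebra
    also have "\<dots> = fact (Suc k) * (poly.coeff (?P n) k - l * real n * poly.coeff (?P n) (Suc k))"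
      unfolding Suc.IH by (simp add: algebra_simps)
    finally show ?thesis
      by (simp add: P Suc algebra_simps)
  qed
qed

text \<open>Expand the degenerate falling factorial in ordinary ones and these in monomials;
  agreement at all real points gives equality of polynomials.\<close>

lemma coeff_deg_ffact:
  "poly.coeff (deg_ffact [:l:] [:0, 1:] n) m = (\<Sum>j\<le>n. stirling1 j m * deg_stirling2 l n j)"
proof -
  have "poly (deg_ffact [:l:] [:0, 1:] n)
      = poly (\<Sum>j\<le>n. smult (deg_stirling2 l n j) (deg_ffact 1 [:0, 1:] j))"
    by (rule ext) (simp add: poly_deg_ffact poly_sum deg_stirling2_identity[of l])
  hence "deg_ffact [:l:] [:0, 1:] n = (\<Sum>j\<le>n. smult (deg_stirling2 l n j) (deg_ffact 1 [:0, 1:] j))"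
    by (simp only: poly_eq_poly_eq_iff)
  thus ?thesis
    by (simp add: coeff_sum stirling1_def mult.commute)
qed

lemma stirling1_eq_0: "j < k \<Longrightarrow> stirling1 j k = 0"
  by (simp add: stirling1_def coeff_eq_0 degree_ffact)

section \<open>The generating function\<close>

lemma integral_std_normal_exp:
  "(\<integral>y. std_normal_density y * exp (s * y) \<partial>lborel) = exp (s\<^sup>2 / 2)"
proof -
  \<comment> \<open>Completing the square leaves the normal density with mean \<open>s\<close>,
    whose integral is 1.\<close>
  have "std_normal_density y * exp (s * y) = exp (s\<^sup>2 / 2) * normal_density s 1 y" for y
    by (simp add: normal_density_def flip: exp_add) (simp add: field_simps power2_eq_square)
  thus ?thesis by simp
qed

lemma deg_mgf_std_normal:
  assumes "distributed M lborel Y std_normal_density" "1 + l * t > 0"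
  shows "deg_mgf l M Y t = exp ((ln (1 + l * t) / l)\<^sup>2 / 2)"
proof -
  have "deg_mgf l M Y t = (\<integral>\<omega>. exp (ln (1 + l * t) / l * Y \<omega>) \<partial>M)"
    using assms(2) by (simp add: deg_mgf_def deg_exp_def powr_def mult.commute)
  also have "\<dots> = (\<integral>y. std_normal_density y * exp (ln (1 + l * t) / l * y) \<partial>lborel)"
    by (rule distributed_integral[OF assms(1), symmetric]) auto
  finally show ?thesis by (simp only: integral_std_normal_exp)
qed

lemma has_fps_expansion_euler:
  "(\<lambda>u::real. 2 / (exp u + 1) * exp (x * u)) has_fps_expansion
     (fps_const 2 / (fps_exp 1 + 1) * fps_exp x)"
  by (rule has_fps_expansion_mult[OF has_fps_expansion_divide'[OF has_fps_expansion_const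
        has_fps_expansion_add[OF has_fps_expansion_exp1 has_fps_expansion_1]]
        has_fps_expansion_exp]) simp

lemma prob_deg_euler_std_normal:
  assumes "l \<noteq> 0" "distributed M lborel Y std_normal_density"
  shows "prob_deg_euler l M Y n x = fact n *
    ((fps_const 2 / (fps_exp 1 + 1) * fps_exp x) oo (fps_const (1/2) * deg_log_fps l ^ 2)) $ n"
proof -
  let ?f = "\<lambda>t. 2 / (deg_mgf l M Y t + 1) * deg_mgf l M Y t powr x"
  let ?u = "\<lambda>t. 1 / 2 * (ln (1 + l * t) / l * (ln (1 + l * t) / l))"
  let ?F = "(fps_const 2 / (fps_exp 1 + 1) * fps_exp x) oo (fps_const (1/2) * deg_log_fps l ^ 2)"
  have "?u has_fps_expansion fps_const (1/2) * (deg_log_fps l * deg_log_fps l)"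
    using assms(1) by (intro fps_expansion_intros has_fps_expansion_deg_log)
  hence "(\<lambda>t. 2 / (exp (?u t) + 1) * exp (x * ?u t)) has_fps_expansion ?F"
    by (intro has_fps_expansion_compose_normed_field[OF has_fps_expansion_euler])
       (simp_all add: power2_eq_square)
  \<comment> \<open>In this ball \<open>1 + l * t\<close> is positive, as the formula for
    \<open>deg_mgf\<close> needs.\<close>
  moreover have "eventually (\<lambda>t. t \<in> ball 0 (1 / \<bar>l\<bar>)) (nhds 0)"
    using assms(1) by (intro eventually_nhds_in_open) auto
  hence "eventually (\<lambda>t. 2 / (exp (?u t) + 1) * exp (x * ?u t) = ?f t) (nhds 0)"
  proof eventually_elim
    case (elim t)
    have "\<bar>l * t\<bar> < 1"
      using elim assms by (simp add: abs_mult field_simps)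
    hence "deg_mgf l M Y t = exp (?u t)"
      by (subst deg_mgf_std_normal[OF assms(2)]) (auto simp: power2_eq_square)
    thus ?case by (simp add: powr_def)
  qed
  ultimately have "?f has_fps_expansion ?F"
    by (rule has_fps_expansion_transform[rotated])
  hence "(THE F. ?f has_fps_expansion F) = ?F"
    by (intro the_equality) (auto intro: has_fps_expansion_unique)
  thus ?thesis by (simp add: prob_deg_euler_def)
qed

theorem theorem3p3:
  fixes M :: "'a measure" and Y :: "'a \<Rightarrow> real" and l x :: real and n :: nat
  assumes "l \<noteq> 0"
    and "prob_space M"
    and "distributed M lborel Y std_normal_density"
  shows "prob_deg_euler l M Y n x =
    (\<Sum>j=0..n. \<Sum>k=0..j div 2. euler_poly k x * real ((2 * k) choose k) * (fact k / 2 ^ k)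
       * stirling1 j (2 * k) * deg_stirling2 l n j)"
proof -
  let ?c = "\<lambda>k. euler_poly k x * real ((2 * k) choose k) * (fact k / 2 ^ k)"
  let ?s = "\<lambda>j k. stirling1 j (2 * k) * deg_stirling2 l n j"
  \<comment> \<open>The right side splits off the coefficient of the Euler series, the factor from
    the \<open>k\<close>-th power of \<open>s\<^sup>2 / 2\<close>, and the
    \<open>fact (2 * k)\<close> that \<open>deg_log_fps_power_nth\<close> produces.\<close>
  have c: "?c k = euler_poly k x / fact k * (1 / 2) ^ k * fact (2 * k)" for k
    using binomial_fact[of k "2 * k", where 'a = real] by (simp add: power_divide field_simps)
  have "prob_deg_euler l M Y n x = (\<Sum>k=0..n. euler_poly k x / fact k * (1 / 2) ^ k
      * (fact n * (deg_log_fps l ^ (2 * k)) $ n))"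
    unfolding prob_deg_euler_std_normal[OF assms(1,3)] fps_compose_nth euler_poly_def sum_distrib_left
    by (intro sum.cong refl)
       (simp add: power_mult_distrib fps_const_power mult_ac flip: power_mult)
  also have "\<dots> = (\<Sum>k=0..n. ?c k * (\<Sum>j=0..n. ?s j k))"
    unfolding deg_log_fps_power_nth[OF assms(1)] coeff_deg_ffact c atMost_atLeast0 by (simp only: mult.assoc)
  also have "\<dots> = (\<Sum>j=0..n. \<Sum>k=0..n. ?c k * ?s j k)"
    unfolding sum_distrib_left by (rule sum.swap)
  \<comment> \<open>The terms with \<open>2 * k > j\<close> vanish because
    \<open>stirling1 j (2 * k) = 0\<close> there.\<close>
  also have "\<dots> = (\<Sum>j=0..n. \<Sum>k=0..j div 2. ?c k * ?s j k)"
    by (intro sum.cong[OF refl] sum.mono_neutral_right) (auto simp: stirling1_eq_0)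
  finally show ?thesis by (simp only: mult.assoc)
qed

end
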